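(* For integers $n,r$ with $2\le r\le\log n$, $$\kappa(n,r)=e^{-H_r}+O\left(\exp\left\{-\frac nr\log\frac ne+\frac n{\log n}+\frac{3n}{(\log n)^2}\right\}\right).$$
   Context: $S_n$ is the symmetric group on $n$ symbols and $k_j(\sigma)$ is the number of cycles of length $j$ in $\sigma\in S_n$. For $1\le r<n$, $$\kappa(n,r)=\frac1{n!}\left|\{\sigma\in S_n:\ k_j(\sigma)=0\text{ for all }1\le j\le r\}\right|.$$ $H_r=\sum_{j=1}^r1/j$. $e$ is Euler's number and $\log$ the natural logarithm. The implied constant in $O(\cdot)$ is absolute (uniform over all $n,r$ in the stated range). *)

theory Defs
  imports "HOL-Analysis.Harmonic_Numbers" "HOL-Combinatorics.Orbits"
begin

text \<open>For \<sigma> a permutation of \<open>{1..n}\<close>, the cycles of \<sigma> are its orbits on \<open>{1..n}\<close>; fixed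
  points are cycles of length 1.\<close>

definition cycle_count :: "nat \<Rightarrow> nat \<Rightarrow> (nat \<Rightarrow> nat) \<Rightarrow> nat" where
  "cycle_count n j \<sigma> = card {c \<in> orbit \<sigma> ` {1..n}. card c = j}"

definition kappa :: "nat \<Rightarrow> nat \<Rightarrow> real" where
  "kappa n r =
     real (card {\<sigma>. \<sigma> permutes {1..n} \<and> (\<forall>j\<in>{1..r}. cycle_count n j \<sigma> = 0)}) / fact n"

end

theory Submission
  imports Defs "HOL-Combinatorics.Cycles" "HOL-Complex_Analysis.Laurent_Convergence"
begin

text \<open>
  Write \<open>A(z) = exp (- (z + z\<^sup>2/2 + \<dots> + z\<^sup>r/r)) = \<Sum> a\<^sub>m z\<^sup>m\<close>. The exponential generating function of
  the permutations without cycles of length at most \<open>r\<close> is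
  \<open>exp (\<Sum>j>r. z\<^sup>j/j) = A(z) / (1 - z)\<close>, so \<open>kappa n r\<close> is the partial sum \<open>a\<^sub>0 + \<dots> + a\<^sub>n\<close>. Since \<open>A\<close> is
  entire, the full series sums to \<open>A(1) = exp (- harm r)\<close>, and the error is the tail beyond \<open>n\<close>.

  The tail is controlled by a majorant: \<open>\<bar>a\<^sub>m\<bar>\<close> is at most the coefficient \<open>b\<^sub>m\<close> of
  \<open>exp (z + z\<^sup>2/2 + \<dots> + z\<^sup>r/r)\<close>, and since the \<open>b\<^sub>m\<close> are nonnegative, every \<open>x \<ge> 1\<close> gives
  \<open>(\<Sum>m>n. b\<^sub>m) \<le> x\<^bsup>-n\<^esup> (\<Sum>m. b\<^sub>m x\<^sup>m) = x\<^bsup>-n\<^esup> exp (\<Sum>j\<le>r. x\<^sup>j/j)\<close>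
  (\<open>kappa_error_le_saddle_bound\<close>). The choice \<open>x = n\<^bsup>1/r\<^esup>\<close> balances the two factors: \<open>x\<^bsup>-n\<^esup>\<close> is
  \<open>exp (- (n/r) log n)\<close>, and the top summand \<open>x\<^sup>r/r = n/r\<close> turns \<open>log n\<close> into \<open>log (n/e)\<close>. The condition
  \<open>r \<le> log n\<close> says that \<open>x \<ge> e\<close>, so the remaining summands decay at least geometrically below the
  top one; they add up to at most \<open>n / log n\<close> (\<open>sum_exp_power_over_le\<close>). The estimate therefore holds
  with constant 1.

  The generating function enters through recurrences only. Splitting off the
  cycle through a fixed point (\<open>bij_betw_split_off_cycle\<close>) shows that the proportions \<open>p\<^sub>n\<close> satisfy
  \<open>n p\<^sub>n = p\<^sub>0 + \<dots> + p\<^bsub>n-r-1\<^esub>\<close>; the differential equation \<open>A' = - (1 + z + \<dots> + z\<^bsup>r-1\<^esup>) A\<close> gives the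
  partial sums of \<open>a\<close> the same recurrence (\<open>partial_sums_recurrence\<close>).
\<close>

section \<open>Permutations all of whose cycles are long\<close>

definition long_cycle_perms :: "nat \<Rightarrow> 'a set \<Rightarrow> ('a \<Rightarrow> 'a) set" where
  "long_cycle_perms r A = {\<sigma>. \<sigma> permutes A \<and> (\<forall>a\<in>A. r < card (orbit \<sigma> a))}"

lemma set_support_eq_orbit:
  assumes "permutation \<sigma>"
  shows "set (support \<sigma> x) = orbit \<sigma> x"
  using support_set[OF assms, of x] orbit_altdef_permutation[OF assms, of x] by auto

lemma length_support_eq_card_orbit:
  assumes "permutation \<sigma>"
  shows "least_power \<sigma> x = card (orbit \<sigma> x)"
  using distinct_card[OF cycle_of_permutation[OF assms, of x]]
  by (simp add: set_support_eq_orbit[OF assms, symmetric])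

lemma support_eq_Cons:
  assumes "permutation \<sigma>"
  shows "support \<sigma> x = x # tl (support \<sigma> x)"
proof -
  have "least_power \<sigma> x > 0" using assms by (rule least_power_of_permutation)
  then have "support \<sigma> x \<noteq> []" and "hd (support \<sigma> x) = x" by (simp_all add: hd_map)
  then show ?thesis by (metis list.collapse)
qed

lemma funpow_cycle_of_list_hd:
  assumes "distinct xs" "i < length xs"
  shows "(cycle_of_list xs ^^ i) (hd xs) = xs ! i"
proof -
  have "xs \<noteq> []" using assms by auto
  then have "(cycle_of_list xs ^^ i) (hd xs) = rotate i xs ! 0"
    by (simp flip: cyclic_rotation[OF assms(1)] add: hd_conv_nth)
  also have "\<dots> = xs ! i"
    using assms \<open>xs \<noteq> []\<close> by (subst nth_rotate) auto
  finally show ?thesis .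
qed

lemma orbit_cycle_of_list_hd:
  assumes "distinct xs" "xs \<noteq> []"
  shows "orbit (cycle_of_list xs) (hd xs) = set xs"
proof
  have "hd xs \<in> set xs" using assms by simp
  then show "orbit (cycle_of_list xs) (hd xs) \<subseteq> set xs"
    by (rule permutes_orbit_subset[OF cycle_permutes])
  show "set xs \<subseteq> orbit (cycle_of_list xs) (hd xs)"
  proof
    fix y assume "y \<in> set xs"
    then obtain i where "i < length xs" "y = xs ! i" by (auto simp: in_set_conv_nth)
    then have "y = (cycle_of_list xs ^^ i) (hd xs)"
      using funpow_cycle_of_list_hd[OF assms(1)] by simp
    then show "y \<in> orbit (cycle_of_list xs) (hd xs)"
      using orbit_altdef_permutation[OF permutation_of_cycle[of xs]] by auto
  qed
qed

text \<open>A permutation can be assembled from one prescribed cycle and a permutation of the remaining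
  points, and both ingredients can be read off from the result. The last two conclusions are what
  makes this construction injective; the two about orbits show that it respects cycle lengths.\<close>

lemma cycle_times_rest:
  assumes "finite A" "distinct xs" "xs \<noteq> []" "set xs \<subseteq> A" "\<tau> permutes (A - set xs)"
  defines "\<sigma> \<equiv> cycle_of_list xs \<circ> \<tau>"
  shows "\<sigma> permutes A"
    and "\<And>a. a \<in> set xs \<Longrightarrow> orbit \<sigma> a = set xs"
    and "\<And>a. a \<in> A - set xs \<Longrightarrow> orbit \<sigma> a = orbit \<tau> a"
    and "support \<sigma> (hd xs) = xs"
    and "perm_restrict \<sigma> (A - set xs) = \<tau>"
proof -
  have cyc: "cycle_of_list xs permutes set xs" by (rule cycle_permutes)
  have "cycle_of_list xs permutes A" "\<tau> permutes A"
    using cyc assms(4,5) by (auto intro: permutes_subset)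
  then show perm: "\<sigma> permutes A"
    unfolding \<sigma>_def by (intro permutes_compose)
  then have permutation: "permutation \<sigma>"
    using assms(1) by (auto simp: permutation_permutes)
  have on_xs: "\<sigma> y = cycle_of_list xs y" if "y \<in> set xs" for y
    unfolding \<sigma>_def using that permutes_not_in[OF assms(5)] by simp
  have off_xs: "\<sigma> y = \<tau> y" if "y \<in> A - set xs" for y
  proof -
    have "\<tau> y \<in> A - set xs" using that permutes_in_image[OF assms(5)] by blast
    then show ?thesis unfolding \<sigma>_def using permutes_not_in[OF cyc] by simp
  qed
  have hd: "hd xs \<in> set xs" using assms(3) by simp
  have orb_hd: "orbit \<sigma> (hd xs) = set xs"
  proof -
    have "orbit \<sigma> (hd xs) = orbit (cycle_of_list xs) (hd xs)"
      using hd on_xs permutes_in_image[OF cyc]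
      by (intro orbit_cong0[where A = "set xs"]) auto
    then show ?thesis using orbit_cycle_of_list_hd[OF assms(2,3)] by simp
  qed
  show "orbit \<sigma> a = set xs" if "a \<in> set xs" for a
    using cyclic_on_orbit'[OF permutation, of "hd xs"] orb_hd that
    by (auto simp: cyclic_on_alldef)
  show "orbit \<sigma> a = orbit \<tau> a" if "a \<in> A - set xs" for a
    using that off_xs permutes_in_image[OF assms(5)]
    by (intro orbit_cong0[where A = "A - set xs"]) auto
  have len: "least_power \<sigma> (hd xs) = length xs"
    using length_support_eq_card_orbit[OF permutation] orb_hd distinct_card[OF assms(2)] by simp
  have "(\<sigma> ^^ i) (hd xs) = xs ! i" if "i < length xs" for i
  proof -
    have "(\<sigma> ^^ i) (hd xs) = (cycle_of_list xs ^^ i) (hd xs) \<and> (\<sigma> ^^ i) (hd xs) \<in> set xs" for i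
    proof (induction i)
      case (Suc i)
      then have eq: "(\<sigma> ^^ i) (hd xs) = (cycle_of_list xs ^^ i) (hd xs)"
        and mem: "(\<sigma> ^^ i) (hd xs) \<in> set xs" by blast+
      from on_xs[OF mem] mem show ?case
        by (simp add: eq permutes_in_image[OF cyc])
    qed (simp add: hd)
    then show ?thesis using funpow_cycle_of_list_hd[OF assms(2) that] by simp
  qed
  then show "support \<sigma> (hd xs) = xs"
    by (intro nth_equalityI) (auto simp: len)
  show "perm_restrict \<sigma> (A - set xs) = \<tau>"
  proof
    fix y
    show "perm_restrict \<sigma> (A - set xs) y = \<tau> y"
    proof (cases "y \<in> A - set xs")
      case True
      then show ?thesis using off_xs by (simp only: perm_restrict_simps)
    next
      case False
      then show ?thesis
        by (simp only: perm_restrict_simps(2)[OF False] permutes_not_in[OF assms(5) False])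
    qed
  qed
qed

text \<open>The cycle through \<open>x\<close> is recorded as the list of the points following \<open>x\<close>. Cutting the cycle at
  \<open>x\<close> makes this list unique, so cycles of length \<open>l + 1\<close> through \<open>x\<close> are counted as distinct lists of
  length \<open>l\<close>, without division by the number of rotations.\<close>

lemma bij_betw_split_off_cycle:
  assumes "finite A" "x \<in> A"
  shows "bij_betw (\<lambda>\<sigma>. (tl (support \<sigma> x), perm_restrict \<sigma> (A - orbit \<sigma> x)))
           (long_cycle_perms r A)
           (SIGMA ys:{ys. distinct ys \<and> set ys \<subseteq> A - {x} \<and> r \<le> length ys}.
              long_cycle_perms r (A - set (x # ys)))"
    (is "bij_betw ?G _ (Sigma ?Y ?N)")
proof (rule bij_betw_byWitness[where f' = "\<lambda>(ys, \<tau>). cycle_of_list (x # ys) \<circ> \<tau>"])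
  show "\<forall>\<sigma>\<in>long_cycle_perms r A. (case ?G \<sigma> of (ys, \<tau>) \<Rightarrow> cycle_of_list (x # ys) \<circ> \<tau>) = \<sigma>"
  proof
    fix \<sigma> assume "\<sigma> \<in> long_cycle_perms r A"
    then have perm: "\<sigma> permutes A" by (simp add: long_cycle_perms_def)
    then have permutation: "permutation \<sigma>"
      using assms(1) by (auto simp: permutation_permutes)
    have rest: "perm_restrict \<sigma> (A - orbit \<sigma> x) permutes (A - orbit \<sigma> x)"
      using perm cyclic_on_orbit[OF perm assms(1)] by (rule perm_restrict_diff_cyclic)
    have "(cycle_of_list (support \<sigma> x) \<circ> perm_restrict \<sigma> (A - orbit \<sigma> x)) y = \<sigma> y" for y
    proof (cases "y \<in> A - orbit \<sigma> x")
      case True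
      then have "perm_restrict \<sigma> (A - orbit \<sigma> x) y \<in> A - orbit \<sigma> x"
        using permutes_in_image[OF rest] by blast
      then show ?thesis using True
        by (simp add: perm_restrict_simps id_outside_supp set_support_eq_orbit[OF permutation]
              del: set_map)
    next
      case False
      show ?thesis
      proof (cases "y \<in> orbit \<sigma> x")
        case True
        then have "y \<in> set (support \<sigma> x)"
          by (simp add: set_support_eq_orbit[OF permutation] del: set_map)
        from cycle_restrict[OF permutation this] False show ?thesis
          by (simp add: perm_restrict_simps)
      next
        case notin: False
        with False have "\<sigma> y = y" using permutes_not_in[OF perm] by blast
        with False notin show ?thesis
          by (simp add: perm_restrict_simps id_outside_supp set_support_eq_orbit[OF permutation]
              del: set_map)
      qed
    qed
    then show "(case ?G \<sigma> of (ys, \<tau>) \<Rightarrow> cycle_of_list (x # ys) \<circ> \<tau>) = \<sigma>"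
      using support_eq_Cons[OF permutation, of x] by (auto simp: fun_eq_iff)
  qed
  show "\<forall>p\<in>Sigma ?Y ?N. ?G (case p of (ys, \<tau>) \<Rightarrow> cycle_of_list (x # ys) \<circ> \<tau>) = p"
  proof
    fix p assume "p \<in> Sigma ?Y ?N"
    then obtain ys \<tau> where p: "p = (ys, \<tau>)" and ys: "distinct ys" "set ys \<subseteq> A - {x}"
      and "\<tau> \<in> ?N ys" by blast
    then have "\<tau> permutes (A - set (x # ys))" by (simp add: long_cycle_perms_def)
    note props = cycle_times_rest[OF assms(1) _ _ _ this]
    have xs: "distinct (x # ys)" "x # ys \<noteq> []" "set (x # ys) \<subseteq> A"
      using ys assms(2) by auto
    have "support (cycle_of_list (x # ys) \<circ> \<tau>) x = x # ys"
      using props(4)[OF xs] by (simp only: list.sel)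
    moreover have "orbit (cycle_of_list (x # ys) \<circ> \<tau>) x = set (x # ys)"
      using props(2)[OF xs] by (simp only: list.set_intros)
    ultimately show "?G (case p of (ys, \<tau>) \<Rightarrow> cycle_of_list (x # ys) \<circ> \<tau>) = p"
      using props(5)[OF xs] by (simp only: p prod.case list.sel)
  qed
  show "?G ` long_cycle_perms r A \<subseteq> Sigma ?Y ?N"
  proof (rule image_subsetI)
    fix \<sigma> assume \<sigma>: "\<sigma> \<in> long_cycle_perms r A"
    then have perm: "\<sigma> permutes A" by (simp add: long_cycle_perms_def)
    then have permutation: "permutation \<sigma>"
      using assms(1) by (auto simp: permutation_permutes)
    define ys where "ys = tl (support \<sigma> x)"
    define \<tau> where "\<tau> = perm_restrict \<sigma> (A - orbit \<sigma> x)"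
    have supp: "support \<sigma> x = x # ys"
      using support_eq_Cons[OF permutation, of x] by (simp add: ys_def)
    have "set (x # ys) = orbit \<sigma> x"
      using set_support_eq_orbit[OF permutation, of x] supp by metis
    moreover have "distinct (x # ys)"
      using cycle_of_permutation[OF permutation, of x] supp by metis
    moreover have "orbit \<sigma> x \<subseteq> A"
      using perm assms(2) by (rule permutes_orbit_subset)
    moreover have "r < length (x # ys)"
      using \<sigma> assms(2) calculation(1) distinct_card[OF calculation(2)]
      by (auto simp: long_cycle_perms_def)
    ultimately have ys: "ys \<in> ?Y" and orb: "orbit \<sigma> x = set (x # ys)" by auto
    have rest: "\<tau> permutes (A - set (x # ys))"
      using perm_restrict_diff_cyclic[OF perm cyclic_on_orbit[OF perm assms(1)], of x]
      by (simp add: \<tau>_def orb)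
    have "orbit \<tau> a = orbit \<sigma> a" if "a \<in> A - set (x # ys)" for a
    proof (rule orbit_cong0[OF that])
      show "\<tau> \<in> (A - set (x # ys)) \<rightarrow> (A - set (x # ys))"
        using permutes_in_image[OF rest] by blast
      show "\<tau> y = \<sigma> y" if "y \<in> A - set (x # ys)" for y
        using that by (simp add: \<tau>_def orb perm_restrict_simps)
    qed
    then have "\<tau> \<in> ?N ys"
      using rest \<sigma> by (auto simp: long_cycle_perms_def)
    with ys show "?G \<sigma> \<in> Sigma ?Y ?N" by (simp add: ys_def \<tau>_def)
  qed
  show "(\<lambda>(ys, \<tau>). cycle_of_list (x # ys) \<circ> \<tau>) ` Sigma ?Y ?N \<subseteq> long_cycle_perms r A"
  proof clarify
    fix ys \<tau> assume ys: "distinct ys" "set ys \<subseteq> A - {x}" "r \<le> length ys" and \<tau>: "\<tau> \<in> ?N ys"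
    then have "\<tau> permutes (A - set (x # ys))" by (simp add: long_cycle_perms_def)
    note props = cycle_times_rest[OF assms(1) _ _ _ this]
    have xs: "distinct (x # ys)" "x # ys \<noteq> []" "set (x # ys) \<subseteq> A"
      using ys assms(2) by auto
    have "r < card (orbit (cycle_of_list (x # ys) \<circ> \<tau>) a)" if "a \<in> A" for a
    proof (cases "a \<in> set (x # ys)")
      case True
      from props(2)[OF xs this] distinct_card[OF xs(1)] ys(3) show ?thesis by simp
    next
      case False
      with that have "a \<in> A - set (x # ys)" by blast
      from props(3)[OF xs this] this \<tau> show ?thesis by (simp add: long_cycle_perms_def)
    qed
    with props(1)[OF xs] show "cycle_of_list (x # ys) \<circ> \<tau> \<in> long_cycle_perms r A"
      by (auto simp: long_cycle_perms_def)
  qed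
qed

text \<open>With \<open>m + 1\<close> points there are \<open>m! / (m - l)!\<close> choices for the \<open>l\<close> points following \<open>x\<close> in its cycle,
  and by induction \<open>(m - l)! p\<^bsub>m-l\<^esub>\<close> choices for the rest, so every \<open>l \<ge> r\<close> contributes \<open>m! p\<^bsub>m-l\<^esub>\<close>. The
  induction runs over finite sets rather than cardinalities because removing a cycle from
  an initial segment of the naturals need not leave an initial segment.\<close>

lemma card_long_cycle_perms:
  fixes p :: "nat \<Rightarrow> real"
  assumes "p 0 = 1" and rec: "\<And>n. real n * p n = (\<Sum>k<n - r. p k)"
  assumes "finite A"
  shows "real (card (long_cycle_perms r A)) = fact (card A) * p (card A)"
  using assms(3)
proof (induction A rule: finite_psubset_induct)
  case (psubset A)
  show ?case
  proof (cases "A = {}")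
    case True
    then have "long_cycle_perms r A = {id}" by (auto simp: long_cycle_perms_def)
    then show ?thesis using True assms(1) by simp
  next
    case False
    then obtain x where x: "x \<in> A" by blast
    define m where "m = card (A - {x})"
    have card_A: "card A = Suc m"
      using card.remove[OF psubset.hyps(1) x] by (simp only: m_def)
    let ?Y = "{ys. distinct ys \<and> set ys \<subseteq> A - {x} \<and> r \<le> length ys}"
    let ?L = "\<lambda>l. {ys. length ys = l \<and> distinct ys \<and> set ys \<subseteq> A - {x}}"
    have finA: "finite (A - {x})" using psubset.hyps by simp
    have len: "length ys \<le> m" if "distinct ys" "set ys \<subseteq> A - {x}" for ys
      using that distinct_card[of ys] card_mono[OF finA, of "set ys"] by (simp add: m_def)
    have finL: "finite (?L l)" for l
      by (rule finite_subset[OF _ finite_lists_length_eq[OF finA, of l]]) auto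
    have Y: "?Y = (\<Union>l\<in>{r..m}. ?L l)" using len by auto
    then have finY: "finite ?Y" using finL by simp
    have finN: "finite (long_cycle_perms r B)" if "finite B" for B :: "'a set"
      using finite_permutations[OF that] by (simp add: long_cycle_perms_def)
    have rest: "real (card (long_cycle_perms r (A - set (x # ys)))) = fact (m - l) * p (m - l)"
      if "ys \<in> ?L l" for ys l
    proof -
      have "card (A - set (x # ys)) = card ((A - {x}) - set ys)"
        by (rule arg_cong[where f = card]) auto
      also have "\<dots> = m - l"
        using that distinct_card[of ys] by (subst card_Diff_subset) (auto simp: m_def)
      finally have "card (A - set (x # ys)) = m - l" .
      moreover have "A - set (x # ys) \<subset> A" using x by auto
      ultimately show ?thesis using psubset.IH by metis
    qed
    have "card (long_cycle_perms r A) = card (SIGMA ys:?Y. long_cycle_perms r (A - set (x # ys)))"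
      using bij_betw_split_off_cycle[OF psubset.hyps(1) x] by (rule bij_betw_same_card)
    also have "\<dots> = (\<Sum>ys\<in>?Y. card (long_cycle_perms r (A - set (x # ys))))"
      using finY finN psubset.hyps by (intro card_SigmaI) auto
    also have "\<dots> = (\<Sum>l\<in>{r..m}. \<Sum>ys\<in>?L l. card (long_cycle_perms r (A - set (x # ys))))"
      unfolding Y by (rule sum.UNION_disjoint) (use finL in auto)
    finally have "real (card (long_cycle_perms r A)) =
        (\<Sum>l\<in>{r..m}. \<Sum>ys\<in>?L l. real (card (long_cycle_perms r (A - set (x # ys)))))"
      by simp
    also have "\<dots> = (\<Sum>l\<in>{r..m}. fact m * p (m - l))"
    proof (rule sum.cong[OF refl])
      fix l assume "l \<in> {r..m}"
      then have l: "l \<le> m" by simp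
      have "card (?L l) = \<Prod>{m - l + 1..m}"
        using card_lists_distinct_length_eq[OF finA, of l] l by (simp add: m_def)
      also have "\<dots> = fact m div fact (m - l)"
        using l by (subst fact_div_fact) auto
      finally have "real (card (?L l)) = fact m / fact (m - l)"
        using l by (simp add: real_of_nat_div fact_dvd)
      then show "(\<Sum>ys\<in>?L l. real (card (long_cycle_perms r (A - set (x # ys))))) = fact m * p (m - l)"
        using rest by simp
    qed
    also have "\<dots> = fact m * (\<Sum>k<Suc m - r. p k)"
      unfolding sum_distrib_left
      by (rule sum.reindex_bij_witness[where i = "\<lambda>k. m - k" and j = "\<lambda>l. m - l"]) auto
    also have "\<dots> = fact (card A) * p (card A)"
      using rec[of "Suc m"] by (simp add: card_A)
    finally show ?thesis .
  qed
qed

lemma kappa_eq_card_long_cycle_perms: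
  "kappa n r = real (card (long_cycle_perms r {1..n})) / fact n"
proof -
  have "(\<forall>j\<in>{1..r}. cycle_count n j \<sigma> = 0) \<longleftrightarrow> (\<forall>a\<in>{1..n}. r < card (orbit \<sigma> a))"
    if "\<sigma> permutes {1..n}" for \<sigma>
  proof -
    have "cycle_count n j \<sigma> = 0 \<longleftrightarrow> (\<forall>a\<in>{1..n}. card (orbit \<sigma> a) \<noteq> j)" for j
      by (auto simp: cycle_count_def)
    moreover have "card (orbit \<sigma> a) \<ge> 1" for a
      using finite_cyclic_on[OF cyclic_on_orbit[OF that]] orbit_nonempty[of \<sigma> a]
      by (simp add: Suc_le_eq card_gt_0_iff)
    ultimately show ?thesis by (force simp: not_le)
  qed
  then have "{\<sigma>. \<sigma> permutes {1..n} \<and> (\<forall>j\<in>{1..r}. cycle_count n j \<sigma> = 0)} =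
      long_cycle_perms r {1..n}"
    by (auto simp: long_cycle_perms_def)
  then show ?thesis by (simp add: kappa_def)
qed

section \<open>Taylor coefficients of the exponential of a truncated logarithm\<close>

text \<open>The recurrence compares coefficients in \<open>f' = s (1 + z + \<dots> + z\<^bsup>r-1\<^esup>) f\<close>. Working over the complex
  numbers yields convergence on the whole line for free, since \<open>f\<close> is entire; taking
  real parts preserves the recurrence because its coefficients are real. The cases needed are
  \<open>s = -1\<close> for the exact series and \<open>s = 1\<close> for its majorant.\<close>

lemma taylor_coeffs_exp_truncated_log:
  fixes s :: real and r :: nat
  obtains a :: "nat \<Rightarrow> real"
  where "a 0 = 1"
    and "\<And>n. real (Suc n) * a (Suc n) = s * (\<Sum>i<r. if n < i then 0 else a (n - i))"
    and "\<And>x. (\<lambda>n. a n * x ^ n) sums exp (s * (\<Sum>j=1..r. x ^ j / real j))"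
proof -
  define f :: "complex \<Rightarrow> complex" where "f = (\<lambda>z. exp (of_real s * (\<Sum>j=1..r. z ^ j / of_nat j)))"
  define F where "F = fps_expansion f 0"
  have holo: "f holomorphic_on A" for A
    unfolding f_def by (intro holomorphic_intros) auto
  have F: "f has_fps_expansion F"
    unfolding F_def using holo by (intro has_fps_expansion_fps_expansion[of UNIV]) auto
  have "(f has_field_derivative of_real s * (\<Sum>i<r. z ^ i) * f z) (at z)" for z
  proof -
    have "((\<lambda>z. \<Sum>j=1..r. z ^ j / of_nat j) has_field_derivative
            (\<Sum>j=1..r. z ^ (j - 1))) (at z)"
      by (rule DERIV_sum) (auto intro!: derivative_eq_intros)
    also have "(\<Sum>j=1..r. z ^ (j - 1)) = (\<Sum>i<r. z ^ i)"
      by (rule sum.reindex_bij_witness[where i = Suc and j = "\<lambda>j. j - 1"]) auto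
    finally have "((\<lambda>z. \<Sum>j=1..r. z ^ j / of_nat j) has_field_derivative (\<Sum>i<r. z ^ i)) (at z)" .
    from DERIV_chain2[OF DERIV_exp DERIV_cmult[OF this, of "of_real s"]] show ?thesis
      unfolding f_def by (simp add: mult.commute)
  qed
  then have "deriv f = (\<lambda>z. of_real s * (\<Sum>i<r. z ^ i) * f z)"
    by (auto intro: DERIV_imp_deriv)
  moreover have "(\<lambda>z. of_real s * (\<Sum>i<r. z ^ i) * f z) has_fps_expansion
      fps_const (of_real s) * (\<Sum>i<r. fps_X ^ i) * F"
    by (intro fps_expansion_intros F)
  ultimately have "fps_deriv F = fps_const (of_real s) * (\<Sum>i<r. fps_X ^ i) * F"
    using has_fps_expansion_deriv[OF F] fps_expansion_unique_complex by metis
  then have "fps_nth (fps_deriv F) n =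
      of_real s * (\<Sum>i<r. if n < i then 0 else fps_nth F (n - i))" for n
    by (simp add: mult.assoc sum_distrib_right fps_sum_nth fps_X_power_mult_nth)
  then have rec: "of_nat (Suc n) * fps_nth F (Suc n) =
      of_real s * (\<Sum>i<r. if n < i then 0 else fps_nth F (n - i))" for n
    by simp
  have sums: "(\<lambda>n. fps_nth F n * z ^ n) sums f z" for z
    using holo by (intro has_fps_expansion_imp_sums_complex[OF F, where r = \<infinity>]) auto
  show ?thesis
  proof (rule that[of "\<lambda>n. Re (fps_nth F n)"])
    have "fps_nth F 0 = f 0" using has_fps_expansion_imp_0_eq_fps_nth_0[OF F] by simp
    also have "f 0 = 1" by (simp add: f_def power_0_left)
    finally show "Re (fps_nth F 0) = 1" by simp
  next
    fix n
    have "Re (of_nat (Suc n) * fps_nth F (Suc n)) =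
        Re (of_real s * (\<Sum>i<r. if n < i then 0 else fps_nth F (n - i)))"
      by (simp only: rec)
    then show "real (Suc n) * Re (fps_nth F (Suc n)) =
        s * (\<Sum>i<r. if n < i then 0 else Re (fps_nth F (n - i)))"
      by (simp add: if_distrib[of Re] cong: if_cong)
  next
    fix x :: real
    have "f (of_real x) = of_real (exp (s * (\<Sum>j=1..r. x ^ j / real j)))"
      by (simp add: f_def flip: exp_of_real)
    with sums_Re[OF sums[of "of_real x"]]
    show "(\<lambda>n. Re (fps_nth F n) * x ^ n) sums exp (s * (\<Sum>j=1..r. x ^ j / real j))"
      by (simp flip: of_real_power)
  qed
qed

text \<open>For the coefficients this is multiplication by \<open>1 / (1 - z)\<close>. Each difference of consecutive
  instances of the claim is the given recurrence, whose right-hand side is a sum over a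
  window of length \<open>r\<close> and hence a difference of two partial sums of \<open>a\<close>.\<close>

lemma partial_sums_recurrence:
  fixes a :: "nat \<Rightarrow> real"
  assumes rec: "\<And>n. real (Suc n) * a (Suc n) = - (\<Sum>i<r. if n < i then 0 else a (n - i))"
  shows "real n * (\<Sum>m\<le>n. a m) = (\<Sum>k<n - r. \<Sum>m\<le>k. a m)"
proof (induction n)
  case (Suc n)
  define p where "p = (\<lambda>n. \<Sum>m\<le>n. a m)"
  have window: "(\<Sum>i<r. if n < i then 0 else a (n - i)) = p n - (if r \<le> n then p (n - r) else 0)"
  proof (induction r)
    case (Suc r)
    have "p (n - r) = p (n - Suc r) + a (n - r)" if "Suc r \<le> n"
    proof -
      have "n - r = Suc (n - Suc r)" using that by simp
      then show ?thesis by (simp add: p_def)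
    qed
    moreover have "p 0 = a 0" by (simp add: p_def)
    ultimately show ?case using Suc by (cases "r = n") (auto simp: not_less_eq_eq)
  qed (simp add: p_def)
  have "real (Suc n) * p (Suc n) = real n * p n + p n + real (Suc n) * a (Suc n)"
    by (simp add: p_def algebra_simps)
  also have "\<dots> = (\<Sum>k<n - r. p k) + (if r \<le> n then p (n - r) else 0)"
    unfolding rec window using Suc by (simp add: p_def)
  also have "\<dots> = (\<Sum>k<Suc n - r. p k)"
    by (simp add: Suc_diff_le)
  finally show ?case by (simp add: p_def)
qed simp

text \<open>The two recurrences differ only in sign, so the triangle inequality propagates the bound.\<close>

lemma coeffs_majorant:
  fixes a b :: "nat \<Rightarrow> real"
  assumes "a 0 = 1" "b 0 = 1"
    and a: "\<And>n. real (Suc n) * a (Suc n) = - (\<Sum>i<r. if n < i then 0 else a (n - i))"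
    and b: "\<And>n. real (Suc n) * b (Suc n) = (\<Sum>i<r. if n < i then 0 else b (n - i))"
  shows "\<bar>a n\<bar> \<le> b n"
proof (induction n rule: less_induct)
  case (less n)
  show ?case
  proof (cases n)
    case 0
    then show ?thesis using assms(1,2) by simp
  next
    case (Suc k)
    have "real (Suc k) * \<bar>a (Suc k)\<bar> = \<bar>real (Suc k) * a (Suc k)\<bar>"
      by (simp only: abs_mult abs_of_nat)
    also have "\<dots> \<le> (\<Sum>i<r. \<bar>if k < i then 0 else a (k - i)\<bar>)"
      unfolding a by (simp only: abs_minus_cancel) (rule sum_abs)
    also have "\<dots> \<le> (\<Sum>i<r. if k < i then 0 else b (k - i))"
      using less Suc by (intro sum_mono) auto
    also have "\<dots> = real (Suc k) * b (Suc k)" by (simp only: b)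
    finally show ?thesis using Suc by (simp del: of_nat_Suc)
  qed
qed

text \<open>This is Rankin's trick: in the tail beyond \<open>n\<close>, inserting the factor \<open>x\<^bsup>m-n\<^esup> \<ge> 1\<close> only increases the
  nonnegative majorant, and then the tail can be completed to the full series.\<close>

lemma kappa_error_le_saddle_bound:
  fixes x :: real
  assumes "x \<ge> 1"
  shows "\<bar>kappa n r - exp (- harm r)\<bar> \<le> exp (\<Sum>j=1..r. x ^ j / real j) / x ^ n"
proof -
  obtain a :: "nat \<Rightarrow> real" where a0: "a 0 = 1"
    and a: "\<And>n. real (Suc n) * a (Suc n) = -1 * (\<Sum>i<r. if n < i then 0 else a (n - i))"
    and a_sums: "\<And>x. (\<lambda>n. a n * x ^ n) sums exp (-1 * (\<Sum>j=1..r. x ^ j / real j))"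
    by (rule taylor_coeffs_exp_truncated_log[of "-1" r]) blast
  obtain b :: "nat \<Rightarrow> real" where b0: "b 0 = 1"
    and b: "\<And>n. real (Suc n) * b (Suc n) = 1 * (\<Sum>i<r. if n < i then 0 else b (n - i))"
    and b_sums: "\<And>x. (\<lambda>n. b n * x ^ n) sums exp (1 * (\<Sum>j=1..r. x ^ j / real j))"
    by (rule taylor_coeffs_exp_truncated_log[of 1 r]) blast
  have ab: "\<bar>a m\<bar> \<le> b m" for m
    using a0 b0 a b by (intro coeffs_majorant[where r = r]) auto
  then have b_nonneg: "b m \<ge> 0" for m using abs_ge_zero order_trans by blast
  have "real (card (long_cycle_perms r {1..n})) = fact (card {1..n}) * (\<Sum>m\<le>card {1..n}. a m)"
    using partial_sums_recurrence[of a r] a a0 by (intro card_long_cycle_perms) auto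
  then have kappa: "kappa n r = (\<Sum>m\<le>n. a m)"
    by (simp add: kappa_eq_card_long_cycle_perms)
  have "a sums exp (- harm r)"
    using a_sums[of 1] by (simp add: harm_def field_simps)
  then have tail: "(\<lambda>m. a (m + Suc n)) sums (exp (- harm r) - kappa n r)"
    by (subst sums_iff_shift) (simp add: kappa lessThan_Suc_atMost)
  let ?B = "exp (\<Sum>j=1..r. x ^ j / real j)"
  have bs: "(\<lambda>m. b m * x ^ m) sums ?B" using b_sums[of x] by simp
  have "norm (a (m + Suc n)) \<le> b (m + Suc n) * x ^ (m + Suc n) / x ^ n" for m
  proof -
    have "norm (a (m + Suc n)) \<le> b (m + Suc n) * 1" using ab by simp
    also have "\<dots> \<le> b (m + Suc n) * x ^ Suc m"
      using assms b_nonneg by (intro mult_left_mono one_le_power) auto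
    also have "\<dots> = b (m + Suc n) * x ^ (m + Suc n) / x ^ n"
      using assms by (simp add: power_add)
    finally show ?thesis .
  qed
  moreover have summ: "summable (\<lambda>m. b (m + Suc n) * x ^ (m + Suc n) / x ^ n)"
    using sums_summable[OF bs] by (intro summable_divide) (subst summable_iff_shift)
  ultimately have "norm (\<Sum>m. a (m + Suc n)) \<le> (\<Sum>m. b (m + Suc n) * x ^ (m + Suc n) / x ^ n)"
    by (rule norm_suminf_le)
  also have "\<dots> = (\<Sum>m. b (m + Suc n) * x ^ (m + Suc n)) / x ^ n"
    using sums_summable[OF bs] by (intro suminf_divide) (subst summable_iff_shift)
  also have "\<dots> \<le> ?B / x ^ n"
  proof (rule divide_right_mono)
    have "(\<Sum>m. b (m + Suc n) * x ^ (m + Suc n)) = ?B - (\<Sum>m<Suc n. b m * x ^ m)"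
      using suminf_minus_initial_segment[OF sums_summable[OF bs], of "Suc n"] sums_unique[OF bs]
      by simp
    moreover have "(\<Sum>m<Suc n. b m * x ^ m) \<ge> 0"
      using b_nonneg assms by (intro sum_nonneg mult_nonneg_nonneg) auto
    ultimately show "(\<Sum>m. b (m + Suc n) * x ^ (m + Suc n)) \<le> ?B" by linarith
  qed (use assms in auto)
  finally show ?thesis
    using sums_unique[OF tail] by (simp add: abs_minus_commute)
qed

section \<open>Optimising the bound\<close>

text \<open>The inductive step from \<open>r\<close> to \<open>r + 1\<close> amounts to \<open>2 (r + 1) / r \<le> e\<close>. This holds from \<open>r = 3\<close> on,
  where it reads \<open>8/3 \<le> e\<close>, so the first three cases are checked by hand.\<close>

lemma sum_exp_over_le:
  assumes "r \<ge> 1"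
  shows "(\<Sum>j=1..r. exp (real j) / real j) \<le> 2 * exp (real r) / real r"
proof -
  define e :: real where "e = exp 1"
  have exp_e: "exp (real j) = e ^ j" for j
    using exp_of_nat_mult[of j "1::real"] by (simp add: e_def)
  have e: "e \<ge> 27 / 10"
    using e_approx_32 by (simp add: e_def abs_if split: if_splits)
  have "(\<Sum>j=1..r. e ^ j / real j) \<le> 2 * e ^ r / real r"
  proof (cases "r \<ge> 3")
    case True
    then show ?thesis
    proof (induction r rule: dec_induct)
      case base
      have "(27/10) * (27/10) \<le> e * e" using e by (intro mult_mono) auto
      moreover have "(e - 27/10) * (e - 27/10) \<ge> 0" by simp
      ultimately have "1 + e / 2 \<le> e * e / 3" using e by (simp add: algebra_simps)
      then have "e * (1 + e / 2) \<le> e * (e * e / 3)" using e by (intro mult_left_mono) auto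
      then show ?case by (simp add: numeral_3_eq_3 algebra_simps)
    next
      case (step r)
      have "2 * (real r + 1) \<le> e * real r"
      proof -
        have "2 * (real r + 1) \<le> 8/3 * real r" using step.hyps by simp
        also have "\<dots> \<le> e * real r" using e by (intro mult_right_mono) auto
        finally show ?thesis .
      qed
      then have "2 / real r \<le> e / (real r + 1)" using step.hyps by (simp add: field_simps)
      then have "e ^ r * (2 / real r) \<le> e ^ r * (e / (real r + 1))"
        using e by (intro mult_left_mono) auto
      then have "2 * e ^ r / real r \<le> e ^ Suc r / real (Suc r)"
        by (simp add: algebra_simps)
      moreover have "2 * e ^ Suc r / real (Suc r) = e ^ Suc r / real (Suc r) + e ^ Suc r / real (Suc r)"
        by simp
      moreover have "(\<Sum>j=1..Suc r. e ^ j / real j) =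
          (\<Sum>j=1..r. e ^ j / real j) + e ^ Suc r / real (Suc r)"
        by simp
      ultimately show ?case using step.IH by linarith
    qed
  next
    case False
    then consider "r = 1" | "r = 2" using assms by linarith
    then show ?thesis
    proof cases
      case 1
      then show ?thesis using e by simp
    next
      case 2
      have "(\<Sum>j=1..2. e ^ j / real j) = e + e * e / 2" by (simp add: numeral_2_eq_2)
      moreover have "e * 2 \<le> e * e" using e by (intro mult_left_mono) auto
      moreover have "2 * e ^ 2 / real 2 = e * e" by (simp add: power2_eq_square)
      ultimately show ?thesis unfolding 2 by linarith
    qed
  qed
  then show ?thesis by (simp add: exp_e)
qed

lemma mult_exp_neg_le:
  fixes u :: real
  assumes "u \<ge> 1" "i \<ge> 1"
  shows "u * exp (- (u * real i)) \<le> exp (- real i)"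
proof -
  have "u \<le> exp (u - 1)" using exp_ge_add_one_self[of "u - 1"] by simp
  also have "\<dots> \<le> exp ((u - 1) * real i)" using assms by (simp add: mult_le_cancel_left1)
  finally have "u * exp (- (u * real i)) \<le> exp ((u - 1) * real i) * exp (- (u * real i))"
    by (intro mult_right_mono) auto
  also have "\<dots> = exp (- real i)" by (simp add: algebra_simps flip: exp_add)
  finally show ?thesis .
qed

text \<open>The first term of the bound is the summand \<open>j = r\<close>. Relative to \<open>exp (u r)\<close>, a lower
  summand is \<open>exp (- u (r - j)) / j\<close>, and raising \<open>u\<close> from 1 shrinks it by at least the factor \<open>1 / u\<close>.
  So the lower summands reduce to the case \<open>u = 1\<close>, where they add up to at most \<open>1 / r\<close>
  by \<open>sum_exp_over_le\<close>.\<close>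

lemma sum_exp_power_over_le:
  fixes u :: real
  assumes "u \<ge> 1" "r \<ge> 1"
  shows "(\<Sum>j=1..r. exp u ^ j / real j) \<le> exp (u * real r) * (1 / real r + 1 / (u * real r))"
proof -
  have "{1..r} = insert r {1..<r}" using assms(2) by auto
  then have split: "(\<Sum>j=1..r. g j) = g r + (\<Sum>j=1..<r. g j)" for g :: "nat \<Rightarrow> real" by simp
  have "u * (\<Sum>j=1..<r. exp u ^ j / real j) \<le> (\<Sum>j=1..<r. exp (u * real r) * exp (- real r) * (exp (real j) / real j))"
    unfolding sum_distrib_left
  proof (rule sum_mono)
    fix j assume j: "j \<in> {1..<r}"
    have "u * exp u ^ j = exp (u * real r) * (u * exp (- (u * real (r - j))))"
      using j by (simp add: of_nat_diff algebra_simps flip: exp_of_nat_mult exp_add)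
    also have "\<dots> \<le> exp (u * real r) * exp (- real (r - j))"
      using j assms(1) by (intro mult_left_mono mult_exp_neg_le) auto
    also have "\<dots> = exp (u * real r) * exp (- real r) * exp (real j)"
      using j by (simp add: of_nat_diff algebra_simps flip: exp_add)
    finally have "u * exp u ^ j / real j \<le> exp (u * real r) * exp (- real r) * exp (real j) / real j"
      by (rule divide_right_mono) simp
    then show "u * (exp u ^ j / real j) \<le> exp (u * real r) * exp (- real r) * (exp (real j) / real j)"
      by simp
  qed
  also have "\<dots> = exp (u * real r) * exp (- real r) * (\<Sum>j=1..<r. exp (real j) / real j)"
    by (simp add: sum_distrib_left)
  also have "\<dots> \<le> exp (u * real r) * exp (- real r) * (exp (real r) / real r)"
    using sum_exp_over_le[OF assms(2)] split[of "\<lambda>j. exp (real j) / real j"]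
    by (intro mult_left_mono) auto
  also have "\<dots> = exp (u * real r) / real r" by (simp add: exp_minus)
  finally have "u * (\<Sum>j=1..<r. exp u ^ j / real j) \<le> exp (u * real r) / real r" .
  then have "u * (\<Sum>j=1..<r. exp u ^ j / real j) / u \<le> exp (u * real r) / real r / u"
    using assms(1) by (intro divide_right_mono) auto
  then have "(\<Sum>j=1..<r. exp u ^ j / real j) \<le> exp (u * real r) * (1 / (u * real r))"
    using assms(1) by (simp add: mult.commute[of u "real r"])
  moreover have "exp u ^ r = exp (u * real r)"
    using exp_of_nat_mult[of r u] by (simp add: mult.commute)
  ultimately show ?thesis unfolding split by (simp add: distrib_left)
qed

theorem corollary3p5:
  shows "\<exists>C::real. C > 0 \<and> (\<forall>n r :: nat. 2 \<le> r \<and> real r \<le> ln (real n) \<longrightarrow>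
    \<bar>kappa n r - exp (- harm r)\<bar>
      \<le> C * exp (- (real n / real r) * ln (real n / exp 1)
                 + real n / ln (real n) + 3 * real n / (ln (real n))\<^sup>2))"
proof (intro exI[of _ 1] conjI allI impI)
  fix n r :: nat
  assume nr: "2 \<le> r \<and> real r \<le> ln (real n)"
  define L where "L = ln (real n)"
  \<comment> \<open>The saddle point bound is used at \<open>exp u\<close>, the \<open>r\<close>-th root of \<open>n\<close>.\<close>
  define u where "u = L / real r"
  have r: "real r > 0" and "L > 0" using nr by (auto simp: L_def)
  then have n: "real n > 0" using nr by (cases "n = 0") (auto simp: L_def)
  have u: "u \<ge> 1" using nr r by (simp add: u_def L_def field_simps)
  have ur: "u * real r = L" using r by (simp add: u_def)
  have eL: "exp L = real n" using n by (simp add: L_def)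
  have "\<bar>kappa n r - exp (- harm r)\<bar> \<le> exp (\<Sum>j=1..r. exp u ^ j / real j) / exp u ^ n"
    using u by (intro kappa_error_le_saddle_bound) simp
  also have "\<dots> = exp ((\<Sum>j=1..r. exp u ^ j / real j) - real n * u)"
    by (simp add: exp_diff exp_of_nat_mult)
  also have "\<dots> \<le> exp (- (real n / real r) * ln (real n / exp 1)
                 + real n / L + 3 * real n / L\<^sup>2)"
  proof -
    have "(\<Sum>j=1..r. exp u ^ j / real j) \<le> real n * (1 / real r + 1 / L)"
      using sum_exp_power_over_le[OF u, of r] nr by (simp add: ur eL)
    also have "\<dots> = real n / real r + real n / L" by (simp add: distrib_left)
    finally have "(\<Sum>j=1..r. exp u ^ j / real j) \<le> real n / real r + real n / L" .
    moreover have "- (real n / real r) * ln (real n / exp 1) = real n / real r - real n * u"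
      using n by (simp add: u_def L_def ln_div right_diff_distrib diff_divide_distrib)
    moreover have "3 * real n / L\<^sup>2 \<ge> 0" by simp
    ultimately show ?thesis unfolding exp_le_cancel_iff by linarith
  qed
  finally show "\<bar>kappa n r - exp (- harm r)\<bar>
      \<le> 1 * exp (- (real n / real r) * ln (real n / exp 1)
                 + real n / ln (real n) + 3 * real n / (ln (real n))\<^sup>2)"
    by (simp add: L_def)
qed simp

end
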